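(* Let $m$ be an odd positive integer, let $h$ be an integer with $1\le h\le m-1$, and let $e$ be an even integer satisfying $e(3^h-1)\equiv \frac{3^m+1}{2}\pmod{3^m-1}$. If $\gcd(3^m-1,\,3^h-2)=1$, then the ternary cyclic code $\mathcal{C}_{(1,e)}$ has parameters $[3^m-1,\ 3^m-2m-1,\ 4]$ and is optimal.
   Context: Let $m$ be a positive integer, $\mathbb{F}_{3^m}$ the finite field with $3^m$ elements, and $\alpha$ a generator of the multiplicative group $\mathbb{F}_{3^m}^*$. For an integer $i$, $m_{\alpha^i}(x)$ denotes the minimal polynomial of $\alpha^i$ over $\mathbb{F}_3$. An $[n,k,d]$ linear code over $\mathbb{F}_3$ is a $k$-dimensional subspace of $\mathbb{F}_3^n$ with minimum Hamming distance $d$. A ternary cyclic code of length $n$ (with $\gcd(n,3)=1$) is identified with an ideal of $\mathbb{F}_3[x]/(x^n-1)$ via $(c_0,\dots,c_{n-1})\mapsto c_0+c_1x+\cdots+c_{n-1}x^{n-1}$; its generator polynomial is the monic polynomial of least degree generating the ideal. $\mathcal{C}_{(i_1,i_2,\dots,i_t)}$ denotes the ternary cyclic code of length $3^m-1$ with generator polynomial $m_{\alpha^{i_1}}(x)m_{\alpha^{i_2}}(x)\cdots m_{\alpha^{i_t}}(x)$. A ternary $[n,k,d]$ code is optimal (in the standard sense) if no linear code over $\mathbb{F}_3$ of length $n$ and dimension $k$ has minimum distance larger than $d$. *)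

theory Defs
  imports
    "Jordan_Normal_Form.VS_Connect"
    "Berlekamp_Zassenhaus.Finite_Field"
    "HOL-Algebra.QuotRing"
    "HOL-Number_Theory.Cong"
begin

(* A three-element index type, needed only to obtain F_3 = Z/3Z as a type of mod_ring. *)
typedef three = "{..<3::nat}"
  by (auto intro: exI[of _ 0])

lemma card_three: "CARD(three) = 3"
  using type_definition.card[OF type_definition_three] by simp

instance three :: prime_card
  by standard (simp add: card_three)

type_synonym gf3 = "three mod_ring"


(* The canonical map from F_3; it is a field homomorphism when 'a has characteristic 3. *)
definition gf3_embed :: "gf3 \<Rightarrow> 'a::ring_1" where
  "gf3_embed c = of_int (to_int_mod_ring c)"

definition is_min_poly :: "'a::field \<Rightarrow> gf3 poly \<Rightarrow> bool" where
  "is_min_poly x p \<longleftrightarrow>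
     monic p \<and> poly (map_poly gf3_embed p) x = 0 \<and>
     (\<forall>q. monic q \<and> poly (map_poly gf3_embed q) x = 0 \<longrightarrow> degree p \<le> degree q)"

definition min_poly :: "'a::field \<Rightarrow> gf3 poly" where
  "min_poly x = (THE p. is_min_poly x p)"

definition is_primitive :: "'a::field \<Rightarrow> bool" where
  "is_primitive x \<longleftrightarrow> range (\<lambda>k::int. x powi k) = UNIV - {0}"


definition linear_code :: "nat \<Rightarrow> 'k::field vec set \<Rightarrow> bool" where
  "linear_code n C \<longleftrightarrow> VectorSpace.subspace class_ring C (module_vec TYPE('k) n)"

definition code_dim :: "nat \<Rightarrow> 'k::field vec set \<Rightarrow> nat" where
  "code_dim n C = vectorspace.dim class_ring (module_vec TYPE('k) n \<lparr>carrier := C\<rparr>)"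

definition hamming_dist :: "'k vec \<Rightarrow> 'k vec \<Rightarrow> nat" where
  "hamming_dist u v = card {i. i < dim_vec u \<and> u $ i \<noteq> v $ i}"

(* A code with fewer than two words gets minimum distance Inf {} = 0. *)
definition min_distance :: "'k vec set \<Rightarrow> nat" where
  "min_distance C = Inf {hamming_dist u v | u v. u \<in> C \<and> v \<in> C \<and> u \<noteq> v}"

definition has_parameters :: "'k::field vec set \<Rightarrow> nat \<Rightarrow> nat \<Rightarrow> nat \<Rightarrow> bool" where
  "has_parameters C n k d \<longleftrightarrow> linear_code n C \<and> code_dim n C = k \<and> min_distance C = d"

definition optimal_code :: "nat \<Rightarrow> 'k::field vec set \<Rightarrow> bool" where
  "optimal_code n C \<longleftrightarrow> linear_code n C \<and>
     (\<forall>D :: 'k vec set. linear_code n D \<and> code_dim n D = code_dim n C \<longrightarrow>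
        min_distance D \<le> min_distance C)"


(* The ideal (x^n - 1) of F[x], and the quotient ring F[x]/(x^n - 1). *)
definition modulus_ideal :: "nat \<Rightarrow> 'k::field poly set" where
  "modulus_ideal n = PIdl\<^bsub>class_ring\<^esub> (Polynomial.monom 1 n - 1)"

definition cyclic_ring :: "nat \<Rightarrow> 'k::field poly set ring" where
  "cyclic_ring n = class_ring Quot modulus_ideal n"

definition residue_class :: "nat \<Rightarrow> 'k::field poly \<Rightarrow> 'k poly set" where
  "residue_class n p = modulus_ideal n +>\<^bsub>class_ring\<^esub> p"

(* The identification of (c_0, ..., c_(n-1)) with the class of c_0 + c_1 x + ... + c_(n-1) x^(n-1). *)
definition word_class :: "nat \<Rightarrow> 'k::field vec \<Rightarrow> 'k poly set" where
  "word_class n c = residue_class n (\<Sum>i<n. Polynomial.monom (c $ i) i)"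

definition cyclic_code :: "nat \<Rightarrow> 'k::field vec set \<Rightarrow> bool" where
  "cyclic_code n C \<longleftrightarrow> C \<subseteq> carrier_vec n \<and> ideal (word_class n ` C) (cyclic_ring n)"

definition generates_code :: "nat \<Rightarrow> 'k::field poly \<Rightarrow> 'k vec set \<Rightarrow> bool" where
  "generates_code n g C \<longleftrightarrow> word_class n ` C = PIdl\<^bsub>cyclic_ring n\<^esub> (residue_class n g)"

definition is_generator_poly :: "nat \<Rightarrow> 'k::field poly \<Rightarrow> 'k vec set \<Rightarrow> bool" where
  "is_generator_poly n g C \<longleftrightarrow> monic g \<and> generates_code n g C \<and>
     (\<forall>h. monic h \<and> generates_code n h C \<longrightarrow> degree g \<le> degree h)"

(* C_(i_1,...,i_t) for the generator \<alpha> of the multiplicative group of 'a = F_(3^m). *)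
definition ternary_cyclic_code :: "nat \<Rightarrow> 'a::field \<Rightarrow> int list \<Rightarrow> gf3 vec set" where
  "ternary_cyclic_code m \<alpha> is =
     (THE C. cyclic_code (3 ^ m - 1) C \<and>
             is_generator_poly (3 ^ m - 1) (prod_list (map (\<lambda>i. min_poly (\<alpha> powi i)) is)) C)"

end

theory Submission
  imports Defs "Berlekamp_Zassenhaus.Berlekamp_Type_Based"
begin

text \<open>
  Let \<open>\<chi>\<close> be the quadratic character and \<open>s\<close> the automorphism
  \<open>x \<mapsto> x ^ (3 ^ h)\<close>. The congruence for \<open>e\<close> says \<open>s (x ^ e) = \<chi> x * x * x ^ e\<close>. A word of
  weight 3 gives \<open>\<plusminus> x \<plusminus> y \<plusminus> z = 0\<close> together with the same relation between the \<open>e\<close>-th powers;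
  applying \<open>s\<close> to the latter yields a third, bilinear relation, which factors in characteristic 3
  for every choice of signs. All cases contradict the facts that \<open>e\<close>-th powers are squares and
  \<open>- 1\<close> is not, except for one that leads to \<open>w ^ (3 ^ h) = w\<^sup>2\<close>; there the coprimality
  assumption forces \<open>w = 1\<close>.

  Moreover \<open>\<alpha>\<close> is up to sign a power of \<open>\<alpha> ^ e\<close>, so both minimal polynomials have degree
  \<open>m\<close>; they are distinct since \<open>\<alpha> ^ e\<close> is a square and \<open>\<alpha>\<close> is not. Sphere packing shows that no
  code of this length and dimension has distance above 4.
\<close>

hide_const (open) up_ring.coeff up_ring.monom

section \<open>Relations between twisted powers in characteristic 3\<close>

text \<open>
  Here \<open>E\<close> stands for the power map with exponent \<open>e\<close>, \<open>s\<close> for the power map with exponent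
  \<open>3 ^ h\<close>, and \<open>\<chi>\<close> for the quadratic character.
\<close>

locale twisted_power =
  fixes E s \<chi> :: "'a::field \<Rightarrow> 'a"
  assumes three_eq_0: "(3::'a) = 0"
    and E_mult: "\<And>x y. E (x * y) = E x * E y"
    and E_minus: "\<And>x. E (- x) = E x"
    and E_nonzero: "\<And>x. x \<noteq> 0 \<Longrightarrow> E x \<noteq> 0"
    and s_add: "\<And>x y. s (x + y) = s x + s y"
    and \<chi>_cases: "\<And>x. x \<noteq> 0 \<Longrightarrow> \<chi> x = 1 \<or> \<chi> x = - 1"
    and \<chi>_mult: "\<And>x y. \<chi> (x * y) = \<chi> x * \<chi> y"
    and \<chi>_minus: "\<And>x. \<chi> (- x) = - \<chi> x"
    and \<chi>_E: "\<And>x. x \<noteq> 0 \<Longrightarrow> \<chi> (E x) = 1"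
    and s_E: "\<And>x. x \<noteq> 0 \<Longrightarrow> s (E x) = \<chi> x * x * E x"
    and s_eq_square: "\<And>w. w \<noteq> 0 \<Longrightarrow> s w = w\<^sup>2 \<Longrightarrow> w = 1"
begin

lemma two_eq: "(2::'a) = - 1"
proof -
  have "(2::'a) + 1 = 3" by simp
  then show ?thesis using three_eq_0 by (simp add: eq_neg_iff_add_eq_0)
qed

lemma one_neq_minus_one: "(1::'a) \<noteq> - 1"
proof
  assume "(1::'a) = - 1"
  then have "(2::'a) = 0" by (metis add.right_inverse one_add_one)
  then show False using two_eq by simp
qed

lemma s_0: "s 0 = 0"
  using s_add[of 0 0] by (simp only: add_0_right add_cancel_right_right)

text \<open>Applying \<open>s\<close> to the equal \<open>E\<close>-values and cancelling leaves
  \<open>\<chi> x * x = \<chi> y * y\<close>, where both characters are signs.\<close>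

lemma E_eqD:
  assumes "x \<noteq> 0" "y \<noteq> 0" "E x = E y"
  shows "x = y \<or> x = - y"
proof -
  have "\<chi> x * x * E x = \<chi> y * y * E x"
    using s_E[OF assms(1)] s_E[OF assms(2)] assms(3) by metis
  then have "\<chi> x * x = \<chi> y * y"
    using E_nonzero[OF assms(1)] mult_right_cancel by blast
  then show ?thesis
    using \<chi>_cases[OF assms(1)] \<chi>_cases[OF assms(2)] by auto
qed

text \<open>Values of \<open>E\<close> have character 1, so both products have the same character;
  since negation flips the character, they cannot be negatives of each other.\<close>

lemma cross_terms_nonzero:
  assumes "x \<noteq> 0" "y \<noteq> 0" "\<chi> x = \<chi> y"
  shows "x * E y + y * E x \<noteq> 0"
proof
  assume "x * E y + y * E x = 0"
  then have "x * E y = - (y * E x)" by (simp add: eq_neg_iff_add_eq_0)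
  then have "\<chi> (x * E y) = - \<chi> (y * E x)" by (simp add: \<chi>_minus)
  then have "\<chi> x = - \<chi> x" using assms by (simp add: \<chi>_mult \<chi>_E)
  then show False using \<chi>_cases[OF assms(1)] one_neq_minus_one by auto
qed

text \<open>Applying \<open>s\<close> gives \<open>x * E x + y * E y + z * E z = 0\<close>. After
  eliminating \<open>z\<close>, the left side is \<open>- (x - y) * (E x - E y)\<close> modulo 3;
  the alternative \<open>x = - y\<close> from \<open>E_eqD\<close> would make \<open>z\<close>
  zero.\<close>

lemma zero_sum_same_character:
  assumes nz: "x \<noteq> 0" "y \<noteq> 0" "z \<noteq> 0"
    and 1: "x + y + z = 0" and 2: "E x + E y + E z = 0"
    and 3: "\<chi> x = \<chi> y" "\<chi> z = \<chi> x"
  shows "x = y"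
proof -
  have z: "z = - (x + y)" "E z = - (E x + E y)"
    using 1 2 add_eq_0_iff by blast+
  have "s (E x) + s (E y) + s (E z) = 0"
    using 2 s_add s_0 by metis
  then have "\<chi> x * (x * E x + y * E y + z * E z) = 0"
    using 3 by (simp add: s_E nz algebra_simps)
  then have "x * E x + y * E y + z * E z = 0"
    using \<chi>_cases[OF nz(1)] by auto
  moreover have "x * E x + y * E y + z * E z
      = 3 * (x * E x + y * E y) - (x - y) * (E x - E y)"
    unfolding z(2) unfolding z(1) by (simp add: algebra_simps)
  ultimately have "(x - y) * (E x - E y) = 0" using three_eq_0 by simp
  then have "x = y \<or> E x = E y" by simp
  then have "x = y \<or> x = - y" using E_eqD nz by blast
  then show ?thesis using 1 nz by auto
qed

text \<open>With the opposite sign at \<open>z\<close>, eliminating \<open>z\<close> cancels the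
  diagonal terms and leaves only the cross terms.\<close>

lemma zero_sum_mixed_character:
  assumes nz: "x \<noteq> 0" "y \<noteq> 0" "z \<noteq> 0"
    and 1: "x + y + z = 0" and 2: "E x + E y + E z = 0"
    and 3: "\<chi> x = \<chi> y" "\<chi> z = - \<chi> x"
  shows False
proof -
  have z: "z = - (x + y)" "E z = - (E x + E y)"
    using 1 2 add_eq_0_iff by blast+
  have "s (E x) + s (E y) + s (E z) = 0"
    using 2 s_add s_0 by metis
  then have "\<chi> x * (x * E x + y * E y - z * E z) = 0"
    using 3 by (simp add: s_E nz algebra_simps)
  then have "x * E x + y * E y - z * E z = 0"
    using \<chi>_cases[OF nz(1)] by auto
  moreover have "x * E x + y * E y - z * E z = - (x * E y + y * E x)"
    unfolding z(2) unfolding z(1) by (simp add: algebra_simps)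
  ultimately show False
    using cross_terms_nonzero[OF nz(1,2) 3(1)] by (metis neg_equal_0_iff_equal)
qed

text \<open>In characteristic 3 every triple \<open>x = y = z\<close> solves both equations, so no
  contradiction can be expected here. Two of the three characters always agree, which up to
  permutation leaves the two cases above.\<close>

lemma zero_sum_imp_eq:
  assumes nz: "x \<noteq> 0" "y \<noteq> 0" "z \<noteq> 0"
    and 1: "x + y + z = 0" and 2: "E x + E y + E z = 0"
  shows "x = y"
proof -
  have p: "x + z + y = 0" "E x + E z + E y = 0" "y + z + x = 0" "E y + E z + E x = 0"
    using 1 2 by (simp_all add: add_ac)
  consider "\<chi> x = \<chi> y" "\<chi> z = \<chi> x" | "\<chi> x = \<chi> y" "\<chi> z = - \<chi> x"
    | "\<chi> x = \<chi> z" "\<chi> y = - \<chi> x" | "\<chi> y = \<chi> z" "\<chi> x = - \<chi> y"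
    using \<chi>_cases[OF nz(1)] \<chi>_cases[OF nz(2)] \<chi>_cases[OF nz(3)] by force
  then show ?thesis
  proof cases
    case 1 then show ?thesis using zero_sum_same_character assms by blast
  next
    case 2 then show ?thesis using zero_sum_mixed_character assms by blast
  next
    case 3 then show ?thesis
      using zero_sum_mixed_character[OF nz(1,3,2) p(1,2)] by blast
  next
    case 4 then show ?thesis
      using zero_sum_mixed_character[OF nz(2,3,1) p(3,4)] by blast
  qed
qed

text \<open>This is the case that calls on \<open>s_eq_square\<close>. The relation becomes
  \<open>z * E y = - (y * E z)\<close>, so \<open>w = - (z / y)\<close> is a fixed point of
  \<open>E\<close> with character 1. Hence \<open>s w = w\<^sup>2\<close> and \<open>w = 1\<close>,
  so \<open>z = - y\<close> and \<open>x = y\<close>, against the characters.\<close>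

lemma sum_eq_mixed_character:
  assumes nz: "x \<noteq> 0" "y \<noteq> 0" "z \<noteq> 0"
    and 1: "x + y = z" and 2: "E x + E y = E z"
    and 3: "\<chi> x = \<chi> z" "\<chi> y = - \<chi> z"
  shows False
proof -
  have "\<chi> x * x * E x + \<chi> y * y * E y = \<chi> z * z * E z"
    using 2 s_add s_E nz by metis
  then have "\<chi> z * (x * E x - y * E y - z * E z) = 0"
    using 3 by (simp add: algebra_simps)
  then have "x * E x - y * E y - z * E z = 0"
    using \<chi>_cases[OF nz(3)] by auto
  moreover have "x * E x - y * E y - z * E z = - (z * E y + y * E z)"
    unfolding 2[symmetric] unfolding 1[symmetric] by (simp add: algebra_simps)
  ultimately have "z * E y + y * E z = 0" by (metis neg_equal_0_iff_equal)
  then have zy: "z * E y = - (y * E z)" by (simp add: eq_neg_iff_add_eq_0)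
  \<comment> \<open>The sign serves twice: \<open>E\<close> ignores it, so that the relation reads
    \<open>E w = w\<close>, and it compensates the opposite characters of \<open>y\<close> and
    \<open>z\<close>, so that \<open>\<chi> w = 1\<close>.\<close>
  define w where "w = - (z / y)"
  have w0: "w \<noteq> 0" using nz by (simp add: w_def)
  have zw: "z = - w * y" using nz by (simp add: w_def)
  have Ez: "E z = E w * E y" by (simp add: zw E_mult E_minus)
  have "y = 0 \<or> E y = 0 \<or> w = E w" using zy unfolding Ez by (simp add: zw algebra_simps)
  then have Ew: "E w = w" using nz E_nonzero by auto
  have "\<chi> z = - (\<chi> w * \<chi> y)" by (simp add: zw \<chi>_mult \<chi>_minus)
  then have "\<chi> w = 1"
    using 3 \<chi>_cases[OF nz(3)] \<chi>_cases[OF w0] one_neq_minus_one by auto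
  then have "s w = w\<^sup>2" using s_E[OF w0] Ew by (simp add: power2_eq_square)
  then have "w = 1" using s_eq_square w0 by blast
  then have "x + y * 2 = 0" using zw 1 by (simp add: algebra_simps)
  moreover have "x - y = (x + y * 2) - 3 * y" by (simp add: algebra_simps)
  ultimately have "x = y" using three_eq_0 by simp
  then show False using 3 \<chi>_cases[OF nz(3)] one_neq_minus_one by auto
qed

text \<open>Moving \<open>z\<close> to the other side exchanges the two outcomes: equal characters
  now leave the cross terms, and an opposite \<open>\<chi> z\<close> leaves the product of
  differences. If \<open>x\<close> or \<open>y\<close> has the deviating character,
  \<open>sum_eq_mixed_character\<close> applies.\<close>

lemma sum_neq:
  assumes nz: "x \<noteq> 0" "y \<noteq> 0" "z \<noteq> 0" and 1: "x + y = z"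
  shows "E x + E y \<noteq> E z"
proof
  assume 2: "E x + E y = E z"
  have 3: "\<chi> x * x * E x + \<chi> y * y * E y = \<chi> z * z * E z"
    using 2 s_add s_E nz by metis
  consider "\<chi> x = \<chi> y" "\<chi> z = \<chi> x" | "\<chi> x = \<chi> y" "\<chi> z = - \<chi> x"
    | "\<chi> x = \<chi> z" "\<chi> y = - \<chi> z" | "\<chi> y = \<chi> z" "\<chi> x = - \<chi> z"
    using \<chi>_cases[OF nz(1)] \<chi>_cases[OF nz(2)] \<chi>_cases[OF nz(3)] by force
  then show False
  proof cases
    case a: 1
    have "\<chi> x * (x * E x + y * E y - z * E z) = 0"
      using 3 a by (simp add: algebra_simps eq_neg_iff_add_eq_0)
    then have "x * E x + y * E y - z * E z = 0" using \<chi>_cases[OF nz(1)] by auto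
    moreover have "x * E x + y * E y - z * E z = - (x * E y + y * E x)"
      unfolding 2[symmetric] unfolding 1[symmetric] by (simp add: algebra_simps)
    ultimately show False
      using cross_terms_nonzero[OF nz(1,2) a(1)] by (metis neg_equal_0_iff_equal)
  next
    case a: 2
    have "\<chi> x * (x * E x + y * E y + z * E z) = 0"
      using 3 a by (simp add: algebra_simps eq_neg_iff_add_eq_0)
    then have "x * E x + y * E y + z * E z = 0" using \<chi>_cases[OF nz(1)] by auto
    moreover have "x * E x + y * E y + z * E z
        = 3 * (x * E x + y * E y) - (x - y) * (E x - E y)"
      unfolding 2[symmetric] unfolding 1[symmetric] by (simp add: algebra_simps)
    ultimately have "(x - y) * (E x - E y) = 0" using three_eq_0 by simp
    then have "x = y \<or> x = - y" using E_eqD nz by auto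
    then have xy: "x = y" using 1 nz by auto
    \<comment> \<open>Since 2 = -1, \<open>z\<close> is \<open>- x\<close>: evenness gives
      \<open>E z = E x\<close>, the second relation \<open>E z = - E x\<close>.\<close>
    then have z: "z = 2 * x" "E z = 2 * E x" using 1 2 by simp_all
    then have "E z = E x" "E z = - E x" using two_eq by (simp_all add: E_minus)
    then have "(2::'a) * E x = 0" by (metis add.right_inverse mult_2)
    then show False using two_eq E_nonzero[OF nz(1)] by simp
  next
    case 3
    then show False using sum_eq_mixed_character[OF nz 1 2] by blast
  next
    case 4
    then show False
      using sum_eq_mixed_character[OF nz(2,1,3)] 1 2 by (simp add: add.commute)
  qed
qed

text \<open>Up to a common sign, the coefficients all agree or exactly one deviates. The first case
  is \<open>zero_sum_imp_eq\<close>; in the others the deviating term moves to the right and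
  \<open>sum_neq\<close> applies.\<close>

lemma no_weight_3_relation:
  assumes nz: "x \<noteq> 0" "y \<noteq> 0" "z \<noteq> 0" and ne: "x \<noteq> y" "y \<noteq> z" "x \<noteq> z"
    and c: "a = 1 \<or> a = - 1" "b = 1 \<or> b = - 1" "c = 1 \<or> c = - 1"
    and 1: "a * x + b * y + c * z = 0" and 2: "a * E x + b * E y + c * E z = 0"
  shows False
proof -
  have all: False if "x + y + z = 0" "E x + E y + E z = 0"
    using zero_sum_imp_eq[OF nz that] ne by blast
  have xy: False if "x + y = z" "E x + E y = E z"
    using sum_neq[OF nz that(1)] that(2) by blast
  have xz: False if "x + z = y" "E x + E z = E y"
    using sum_neq[OF nz(1,3,2) that(1)] that(2) by blast
  have yz: False if "y + z = x" "E y + E z = E x"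
    using sum_neq[OF nz(2,3,1) that(1)] that(2) by blast
  have "(a = b \<and> c = a) \<or> (a = b \<and> c = - a) \<or> (a = c \<and> b = - a) \<or> (b = c \<and> a = - b)"
    using c by auto
  then consider "a * (x + y + z) = 0" "a * (E x + E y + E z) = 0"
    | "a * (x + y - z) = 0" "a * (E x + E y - E z) = 0"
    | "a * (x + z - y) = 0" "a * (E x + E z - E y) = 0"
    | "b * (y + z - x) = 0" "b * (E y + E z - E x) = 0"
    using 1 2 by (elim disjE conjE) (simp_all add: algebra_simps)
  then show False using c all xy xz yz by cases auto
qed

text \<open>Opposite coefficients force \<open>x = y\<close>. Equal ones force
  \<open>x = - y\<close>, and evenness of \<open>E\<close> then leaves
  \<open>2 * E y = 0\<close>.\<close>

lemma no_weight_2_relation: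
  assumes nz: "x \<noteq> 0" "y \<noteq> 0" and ne: "x \<noteq> y"
    and c: "a = 1 \<or> a = - 1" "b = 1 \<or> b = - 1"
    and 1: "a * x + b * y = 0" and 2: "a * E x + b * E y = 0"
  shows False
proof -
  have "a = b \<or> b = - a" using c by auto
  then have "a * (x + y) = 0 \<and> a * (E x + E y) = 0 \<or> a * (x - y) = 0"
    using 1 2 by (auto simp: algebra_simps)
  then have "x = - y" "E x + E y = 0" using c ne by (auto simp: eq_neg_iff_add_eq_0)
  then have "2 * E y = 0" using E_minus by simp
  then show False using two_eq E_nonzero[OF nz(2)] by simp
qed

end

section \<open>Evaluation of ternary polynomials\<close>

definition word_poly :: "nat \<Rightarrow> 'k::field vec \<Rightarrow> 'k poly" where
  "word_poly n c = (\<Sum>i<n. monom (c $ i) i)"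

lemma coeff_word_poly: "coeff (word_poly n c) i = (if i < n then c $ i else 0)"
  unfolding word_poly_def by (simp add: coeff_sum)

text \<open>Bounding coefficients instead of requiring \<open>degree p < n\<close> keeps the zero
  polynomial in the set when \<open>n = 0\<close>.\<close>

lemma bij_betw_word_poly:
  "bij_betw (word_poly n) (carrier_vec n) {p :: 'k::field poly. \<forall>i\<ge>n. coeff p i = 0}"
proof (rule bij_betw_imageI)
  show "inj_on (word_poly n) (carrier_vec n :: 'k vec set)"
  proof (rule inj_onI)
    fix c d :: "'k vec"
    assume c: "c \<in> carrier_vec n" and d: "d \<in> carrier_vec n"
      and "word_poly n c = word_poly n d"
    then have "c $ i = d $ i" if "i < n" for i
      using that coeff_word_poly[of n c i] coeff_word_poly[of n d i] by simp
    then show "c = d" using c d by (intro eq_vecI) auto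
  qed
  show "word_poly n ` carrier_vec n = {p :: 'k poly. \<forall>i\<ge>n. coeff p i = 0}"
  proof (intro equalityI subsetI)
    fix p :: "'k poly"
    assume p: "p \<in> {p. \<forall>i\<ge>n. coeff p i = 0}"
    have "p = word_poly n (vec n (coeff p))"
      using p by (intro poly_eqI) (auto simp: coeff_word_poly)
    then show "p \<in> word_poly n ` carrier_vec n" by auto
  qed (auto simp: coeff_word_poly)
qed

lemma card_polys_below:
  "card {p :: gf3 poly. \<forall>i\<ge>n. coeff p i = 0} = 3 ^ n"
  using bij_betw_same_card[OF bij_betw_word_poly[where ?'k = gf3 and n = n]]
    card_carrier_vec[where ?'b = gf3 and n = n]
  by (simp add: card_three)

lemma degree_less_imp_coeff_eq_0: "degree p < n \<Longrightarrow> \<forall>i\<ge>n. coeff p i = 0"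
  by (auto intro: coeff_eq_0)

lemma coeff_eq_0_imp_degree_less:
  "\<forall>i\<ge>n. coeff p i = 0 \<Longrightarrow> 0 < n \<Longrightarrow> degree p < n"
  by (metis degree_0 leading_coeff_0_iff not_less)

text \<open>Sums and products of integer representatives are reduced modulo 3, which is invisible in
  a field where 3 = 0.\<close>

lemma gf3_embed_hom:
  assumes "(3::'a::field) = 0"
  shows "comm_ring_hom (gf3_embed :: gf3 \<Rightarrow> 'a)"
proof -
  have mod3: "of_int (k mod 3) = (of_int k :: 'a)" for k
  proof -
    have "of_int k = (of_int (3 * (k div 3) + k mod 3) :: 'a)" by simp
    also have "\<dots> = of_int (k mod 3)" unfolding of_int_add of_int_mult using assms by simp
    finally show ?thesis ..
  qed
  show ?thesis
    by unfold_locales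
      (simp_all add: gf3_embed_def to_int_mod_ring_add to_int_mod_ring_mult card_three mod3
        to_int_mod_ring_hom.hom_one)
qed

lemma gf3_cases:
  fixes c :: gf3
  shows "c = 0 \<or> c = 1 \<or> c = - 1"
proof -
  obtain i where "i < CARD(three)" "c = of_nat i" using surj_of_nat_mod_ring by blast
  then have "c = 0 \<or> c = 1 \<or> c = 2" by (auto simp: card_three less_Suc_eq numeral_3_eq_3)
  moreover have "(2::gf3) = - 1"
  proof -
    have "(3::gf3) = 0" using of_nat_card_eq_0[where ?'a = three] by (simp add: card_three)
    moreover have "(2::gf3) + 1 = 3" by simp
    ultimately show ?thesis by (metis eq_neg_iff_add_eq_0)
  qed
  ultimately show ?thesis by simp
qed

locale ternary_evaluation =
  fixes x :: "'a::{field,finite}"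
  assumes three_eq_0: "(3::'a) = 0"
begin

abbreviation ev :: "gf3 poly \<Rightarrow> 'a" where
  "ev p \<equiv> poly (map_poly gf3_embed p) x"

sublocale embed: comm_ring_hom "gf3_embed :: gf3 \<Rightarrow> 'a"
  using gf3_embed_hom three_eq_0 .

sublocale embed_poly: map_poly_comm_ring_hom "gf3_embed :: gf3 \<Rightarrow> 'a" ..

sublocale ev: comm_ring_hom ev
  by unfold_locales (simp_all add: hom_distribs)

lemma ev_monom: "ev (monom c i) = gf3_embed c * x ^ i"
  by (simp add: poly_monom)

lemma ev_word_poly: "ev (word_poly n c) = (\<Sum>i<n. gf3_embed (c $ i) * x ^ i)"
  unfolding word_poly_def ev.hom_sum ev_monom ..

lemma normalized_annihilator:
  assumes "p \<noteq> 0" "ev p = 0"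
  obtains q where "monic q" "ev q = 0" "degree q = degree p"
proof
  let ?q = "smult (inverse (lead_coeff p)) p"
  show "monic ?q" "degree ?q = degree p" using assms(1) by auto
  show "ev ?q = 0" using assms(2) by (simp add: hom_distribs)
qed

text \<open>Powers of \<open>x\<close> repeat in a finite field, so a difference of two monomials
  annihilates \<open>x\<close>; among the monic annihilators one has least degree.\<close>

lemma ex_is_min_poly: "\<exists>p. is_min_poly x p"
proof -
  have "finite (range (\<lambda>i::nat. x ^ i))" by simp
  then have "\<not> inj (\<lambda>i::nat. x ^ i)"
    using infinite_UNIV_nat finite_imageD by blast
  then obtain i j :: nat where ij: "x ^ i = x ^ j" "i \<noteq> j"
    unfolding inj_def by blast
  let ?p = "monom 1 i - monom 1 j :: gf3 poly"
  have "coeff ?p i \<noteq> 0" using ij(2) by simp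
  then have "?p \<noteq> 0" by (metis coeff_0)
  moreover have "ev ?p = 0" using ij(1) by (simp only: ev.hom_minus ev_monom) simp
  ultimately obtain q where "monic q \<and> ev q = 0"
    using normalized_annihilator by blast
  from ex_has_least_nat[of "\<lambda>q. monic q \<and> ev q = 0", OF this, of degree]
  show ?thesis unfolding is_min_poly_def by blast
qed

text \<open>The remainder of an annihilator modulo \<open>m\<close> again annihilates
  \<open>x\<close>, so minimality of the degree forces it to vanish.\<close>

lemma is_min_poly_dvd_iff:
  assumes "is_min_poly x m"
  shows "ev p = 0 \<longleftrightarrow> m dvd p"
proof
  have m: "monic m" "ev m = 0" using assms unfolding is_min_poly_def by auto
  {
    assume "m dvd p"
    then show "ev p = 0" using m(2) by (auto simp: dvd_def ev.hom_mult)
  next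
    assume "ev p = 0"
    moreover have "ev p = ev (m * (p div m) + p mod m)" by simp
    ultimately have r: "ev (p mod m) = 0" using m(2) by (simp only: ev.hom_add ev.hom_mult) simp
    have "p mod m = 0"
    proof (rule ccontr)
      assume ne: "p mod m \<noteq> 0"
      then obtain q where "monic q" "ev q = 0" "degree q = degree (p mod m)"
        using normalized_annihilator r by blast
      then have "degree m \<le> degree (p mod m)"
        using assms unfolding is_min_poly_def by metis
      moreover have "degree (p mod m) < degree m"
        using ne m(1) by (metis degree_mod_less leading_coeff_0_iff zero_neq_one)
      ultimately show False by simp
    qed
    then show "m dvd p" by auto
  }
qed

text \<open>Two minimal polynomials divide each other and are monic, so the definite description in
  \<open>min_poly\<close> is justified.\<close>

lemma is_min_poly_min_poly: "is_min_poly x (min_poly x)"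
proof -
  obtain p where p: "is_min_poly x p" using ex_is_min_poly by blast
  have "q = p" if q: "is_min_poly x q" for q
  proof -
    have "p dvd q" "q dvd p"
      using p q is_min_poly_dvd_iff[OF p, of q] is_min_poly_dvd_iff[OF q, of p]
      unfolding is_min_poly_def by auto
    then show ?thesis using p q poly_dvd_antisym[of q p] unfolding is_min_poly_def by simp
  qed
  then show ?thesis unfolding min_poly_def using p by (metis theI)
qed

lemmas min_poly_dvd_iff = is_min_poly_dvd_iff[OF is_min_poly_min_poly]

lemma monic_min_poly: "monic (min_poly x)"
  using is_min_poly_min_poly unfolding is_min_poly_def by blast

lemma min_poly_nonzero: "min_poly x \<noteq> 0"
  using monic_min_poly by auto

text \<open>The multiples of \<open>min_poly x\<close> form the kernel of a homomorphism into a
  field, which is a prime ideal.\<close>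

lemma prime_elem_min_poly: "prime_elem (min_poly x)"
proof (rule prime_elemI)
  show "min_poly x \<noteq> 0" by (rule min_poly_nonzero)
  show "\<not> is_unit (min_poly x)" using min_poly_dvd_iff[of 1] by simp
  show "min_poly x dvd a \<or> min_poly x dvd b" if "min_poly x dvd a * b" for a b
    using that unfolding min_poly_dvd_iff[symmetric] by (simp only: ev.hom_mult mult_eq_0_iff)
qed

lemma degree_min_poly_pos: "0 < degree (min_poly x)"
  using prime_elem_min_poly monic_degree_0[OF monic_min_poly]
  by (metis gr0I not_prime_elem_one)

text \<open>Each value is attained by exactly one remainder modulo the minimal polynomial. Read
  backwards, the size of the image determines the degree.\<close>

lemma card_range_ev: "card (range ev) = 3 ^ degree (min_poly x)"
proof -
  let ?d = "degree (min_poly x)"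
  have "bij_betw ev {p. \<forall>i\<ge>?d. coeff p i = 0} (range ev)"
  proof (rule bij_betw_imageI)
    show "inj_on ev {p. \<forall>i\<ge>?d. coeff p i = 0}"
    proof (rule inj_onI)
      fix p q assume pq: "p \<in> {p. \<forall>i\<ge>?d. coeff p i = 0}" "q \<in> {p. \<forall>i\<ge>?d. coeff p i = 0}" "ev p = ev q"
      then have "ev (p - q) = 0" by (simp only: ev.hom_minus) simp
      then have "min_poly x dvd p - q" using min_poly_dvd_iff by blast
      moreover have "degree (p - q) < ?d"
        using pq degree_min_poly_pos by (intro coeff_eq_0_imp_degree_less) auto
      ultimately show "p = q" by (metis dvd_imp_degree_le leD right_minus_eq)
    qed
    show "ev ` {p. \<forall>i\<ge>?d. coeff p i = 0} = range ev"
    proof (intro equalityI subsetI)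
      fix y assume "y \<in> range ev"
      then obtain p where y: "y = ev p" by blast
      have "ev p = ev (min_poly x * (p div min_poly x) + p mod min_poly x)" by simp
      also have "\<dots> = ev (p mod min_poly x)"
        using min_poly_dvd_iff[of "min_poly x"] by (simp only: ev.hom_add ev.hom_mult) simp
      finally have "y = ev (p mod min_poly x)" using y by simp
      moreover have "degree (p mod min_poly x) < ?d"
        using degree_mod_less'[of "min_poly x" p] degree_min_poly_pos min_poly_nonzero
        by (cases "p mod min_poly x = 0") auto
      ultimately show "y \<in> ev ` {p. \<forall>i\<ge>?d. coeff p i = 0}"
        using degree_less_imp_coeff_eq_0 by blast
    qed auto
  qed
  from bij_betw_same_card[OF this] show ?thesis by (simp add: card_polys_below)
qed

end

section \<open>Cyclic codes as multiples of a generator\<close>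

abbreviation x_pow_minus_1 :: "nat \<Rightarrow> 'k::field poly" where
  "x_pow_minus_1 n \<equiv> monom 1 n - 1"

lemma modulus_ideal_eq: "modulus_ideal n = {p. x_pow_minus_1 n dvd p}"
  unfolding modulus_ideal_def cgenideal_def by (auto simp: dvd_def mult.commute)

lemma ideal_modulus: "ideal (modulus_ideal n) (class_ring :: 'k::field poly ring)"
  unfolding modulus_ideal_def by (rule cring.cgenideal_ideal[OF class_cring.is_cring]) simp

lemma mem_residue_class: "q \<in> residue_class n p \<longleftrightarrow> x_pow_minus_1 n dvd q - p"
proof -
  have "q \<in> residue_class n p \<longleftrightarrow> (\<exists>h. x_pow_minus_1 n dvd h \<and> q = h + p)"
    unfolding residue_class_def a_r_coset_def' modulus_ideal_eq by auto
  also have "\<dots> \<longleftrightarrow> x_pow_minus_1 n dvd q - p"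
    by (metis add_diff_cancel diff_add_cancel)
  finally show ?thesis .
qed

lemma residue_class_eq_iff:
  "residue_class n p = residue_class n q \<longleftrightarrow> x_pow_minus_1 n dvd p - q"
proof
  assume "residue_class n p = residue_class n q"
  then show "x_pow_minus_1 n dvd p - q"
    using mem_residue_class[of p n p] mem_residue_class[of p n q] by simp
next
  assume a: "x_pow_minus_1 n dvd p - q"
  have "x_pow_minus_1 n dvd r - p \<longleftrightarrow> x_pow_minus_1 n dvd r - q" for r
    using dvd_add_left_iff[OF a, of "r - p"] by simp
  then show "residue_class n p = residue_class n q"
    by (auto simp: mem_residue_class)
qed

lemma carrier_cyclic_ring: "carrier (cyclic_ring n) = range (residue_class n)"
  unfolding cyclic_ring_def FactRing_def A_RCOSETS_def' residue_class_def by auto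

lemma cring_cyclic_ring: "cring (cyclic_ring n :: 'k::field poly set ring)"
  unfolding cyclic_ring_def
  by (rule ideal.quotient_is_cring[OF ideal_modulus]) (rule class_cring.is_cring)

lemma mult_residue_class:
  "residue_class n p \<otimes>\<^bsub>cyclic_ring n\<^esub> residue_class n q = residue_class n (p * q)"
  unfolding cyclic_ring_def FactRing_def residue_class_def
  using ideal.rcoset_mult_add[OF ideal_modulus] by simp

lemma principal_ideal_cyclic_ring:
  "PIdl\<^bsub>cyclic_ring n\<^esub> (residue_class n g) = {residue_class n (a * g) | a. True}"
  unfolding cgenideal_def carrier_cyclic_ring by (auto simp: mult_residue_class)
    (metis mult_residue_class rangeI)

lemma degree_x_pow_minus_1:
  assumes "0 < n"
  shows "degree (x_pow_minus_1 n :: 'k::field poly) = n"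
proof (rule antisym)
  show "degree (x_pow_minus_1 n :: 'k poly) \<le> n"
    using assms by (intro degree_diff_le) (simp_all add: degree_monom_le)
  show "n \<le> degree (x_pow_minus_1 n :: 'k poly)"
    using assms by (intro le_degree) simp
qed

lemma word_class_eq: "word_class n c = residue_class n (word_poly n c)"
  unfolding word_class_def word_poly_def ..

text \<open>The remainder modulo \<open>x_pow_minus_1 n\<close> is the word polynomial that
  represents the class.\<close>

lemma word_class_cases:
  assumes "0 < n"
  obtains c where "c \<in> carrier_vec n" "residue_class n (p :: 'k::field poly) = word_class n c"
    "x_pow_minus_1 n dvd p - word_poly n c"
proof -
  let ?M = "x_pow_minus_1 n :: 'k poly"
  have nz: "?M \<noteq> 0" using degree_x_pow_minus_1[OF assms, where ?'k = 'k] assms by auto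
  have "degree (p mod ?M) < n"
    using degree_mod_less'[OF nz, of p] degree_x_pow_minus_1[OF assms, where ?'k = 'k] assms
    by (cases "p mod ?M = 0") auto
  then have "p mod ?M \<in> {p. \<forall>i\<ge>n. coeff p i = 0}"
    using degree_less_imp_coeff_eq_0 by blast
  then have "p mod ?M \<in> word_poly n ` carrier_vec n"
    using bij_betw_imp_surj_on[OF bij_betw_word_poly[where ?'k = 'k and n = n]] by simp
  then obtain c where c: "c \<in> carrier_vec n" "p mod ?M = word_poly n c" by auto
  have "?M dvd p - word_poly n c" unfolding c(2)[symmetric] by (rule dvd_minus_mod)
  then show ?thesis using that[OF c(1)] residue_class_eq_iff word_class_eq by metis
qed

text \<open>Two word polynomials differ by a polynomial of degree below \<open>n\<close>, which
  \<open>x_pow_minus_1 n\<close> divides only if it is 0.\<close>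

lemma inj_on_word_class: "inj_on (word_class n) (carrier_vec n :: 'k::field vec set)"
proof (rule inj_onI)
  fix c d :: "'k vec"
  assume c: "c \<in> carrier_vec n" and d: "d \<in> carrier_vec n"
    and eq: "word_class n c = word_class n d"
  show "c = d"
  proof (cases "n = 0")
    case True
    then show ?thesis using c d by auto
  next
    case False
    have dvd: "x_pow_minus_1 n dvd word_poly n c - word_poly n d"
      using eq by (simp add: word_class_eq residue_class_eq_iff)
    have "degree (word_poly n c - word_poly n d) < n"
      using False by (intro coeff_eq_0_imp_degree_less) (auto simp: coeff_word_poly)
    then have "word_poly n c = word_poly n d"
      using dvd degree_x_pow_minus_1[of n, where ?'k = 'k] False
      by (metis dvd_imp_degree_le leD neq0_conv right_minus_eq)
    then show ?thesis
      using bij_betw_imp_inj_on[OF bij_betw_word_poly, of n] c d by (auto dest: inj_onD)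
  qed
qed

text \<open>For \<open>g\<close> dividing \<open>x_pow_minus_1 n\<close> this is the cyclic code
  generated by \<open>g\<close>, described without residue classes.\<close>

definition multiples_code :: "nat \<Rightarrow> 'k::field poly \<Rightarrow> 'k vec set" where
  "multiples_code n g = {c \<in> carrier_vec n. g dvd word_poly n c}"

text \<open>As \<open>g\<close> divides the modulus, divisibility by \<open>g\<close> does not
  depend on the representative.\<close>

lemma residue_class_mem_principal_iff:
  assumes "g dvd x_pow_minus_1 n"
  shows "residue_class n p \<in> PIdl\<^bsub>cyclic_ring n\<^esub> (residue_class n g) \<longleftrightarrow> g dvd p"
proof
  assume "residue_class n p \<in> PIdl\<^bsub>cyclic_ring n\<^esub> (residue_class n g)"
  then obtain a where "x_pow_minus_1 n dvd p - a * g"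
    unfolding principal_ideal_cyclic_ring by (auto simp: residue_class_eq_iff)
  then have "g dvd p - a * g" using assms by (rule dvd_trans[rotated])
  then show "g dvd p" by (metis diff_add_cancel dvd_add dvd_triv_right)
next
  assume "g dvd p"
  then obtain a where "p = a * g" by (metis dvdE mult.commute)
  then show "residue_class n p \<in> PIdl\<^bsub>cyclic_ring n\<^esub> (residue_class n g)"
    unfolding principal_ideal_cyclic_ring by auto
qed

lemma generates_multiples_code:
  fixes g :: "'k::field poly"
  assumes n: "0 < n" and g: "g dvd x_pow_minus_1 n"
  shows "generates_code n g (multiples_code n g)"
  unfolding generates_code_def
proof (intro equalityI subsetI)
  fix y assume "y \<in> word_class n ` multiples_code n g"
  then show "y \<in> PIdl\<^bsub>cyclic_ring n\<^esub> (residue_class n g)"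
    using residue_class_mem_principal_iff[OF g] by (auto simp: multiples_code_def word_class_eq)
next
  fix y assume y: "y \<in> PIdl\<^bsub>cyclic_ring n\<^esub> (residue_class n g)"
  then obtain p where p: "y = residue_class n p"
    unfolding principal_ideal_cyclic_ring by auto
  obtain c where c: "c \<in> carrier_vec n" "residue_class n p = word_class n c"
    using word_class_cases[OF n] by blast
  then show "y \<in> word_class n ` multiples_code n g"
    using y p residue_class_mem_principal_iff[OF g] by (auto simp: multiples_code_def word_class_eq)
qed

lemma generates_code_unique:
  assumes "generates_code n g C" "generates_code n g D" "C \<subseteq> carrier_vec n" "D \<subseteq> carrier_vec n"
  shows "C = D"
  using assms inj_on_image_eq_iff[OF inj_on_word_class] unfolding generates_code_def by metis

lemma cyclic_code_multiples_code:
  assumes n: "0 < n" and g: "g dvd x_pow_minus_1 n"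
  shows "cyclic_code n (multiples_code n g)"
proof -
  have "ideal (PIdl\<^bsub>cyclic_ring n\<^esub> (residue_class n g)) (cyclic_ring n)"
    by (rule cring.cgenideal_ideal[OF cring_cyclic_ring]) (simp add: carrier_cyclic_ring)
  then show ?thesis
    using generates_multiples_code[OF assms]
    unfolding cyclic_code_def generates_code_def by (auto simp: multiples_code_def)
qed

text \<open>The class of any other generator \<open>h\<close> lies in the ideal of \<open>g\<close>,
  which means \<open>g dvd h\<close> and bounds the degree.\<close>

lemma is_generator_poly_multiples_code:
  assumes n: "0 < n" and g: "g dvd x_pow_minus_1 n" "monic g"
  shows "is_generator_poly n g (multiples_code n g)"
  unfolding is_generator_poly_def
proof (intro conjI allI impI)
  show "generates_code n g (multiples_code n g)"
    using generates_multiples_code[OF n g(1)] .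
  fix h assume h: "monic h \<and> generates_code n h (multiples_code n g)"
  have "residue_class n h \<in> PIdl\<^bsub>cyclic_ring n\<^esub> (residue_class n h)"
    unfolding principal_ideal_cyclic_ring by (auto intro: exI[of _ 1])
  then have "residue_class n h \<in> PIdl\<^bsub>cyclic_ring n\<^esub> (residue_class n g)"
    using h generates_multiples_code[OF n g(1)] unfolding generates_code_def by simp
  then have "g dvd h" using residue_class_mem_principal_iff[OF g(1)] by blast
  moreover have "h \<noteq> 0" using h by auto
  ultimately show "degree g \<le> degree h" by (rule dvd_imp_degree_le)
qed (rule g(2))

text \<open>The generator fixes the ideal, and the ideal fixes the code because
  \<open>word_class\<close> is injective on words of length \<open>n\<close>; so the definite
  description has exactly one candidate.\<close>

lemma ternary_cyclic_code_eq:
  fixes \<alpha> :: "'a::field"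
  assumes m: "1 \<le> m" and g: "g = prod_list (map (\<lambda>i. min_poly (\<alpha> powi i)) is)"
    and g_monic: "monic g" and g_dvd: "g dvd x_pow_minus_1 (3 ^ m - 1)"
  shows "ternary_cyclic_code m \<alpha> is = multiples_code (3 ^ m - 1) g"
proof -
  have n: "0 < (3::nat) ^ m - 1" using m one_less_power[of "3::nat" m] by simp
  note facts = cyclic_code_multiples_code[OF n g_dvd]
    is_generator_poly_multiples_code[OF n g_dvd g_monic]
  show ?thesis
    unfolding ternary_cyclic_code_def g[symmetric]
  proof (rule the_equality)
    fix C assume C: "cyclic_code (3 ^ m - 1) C \<and> is_generator_poly (3 ^ m - 1) g C"
    show "C = multiples_code (3 ^ m - 1) g"
    proof (rule generates_code_unique)
      show "generates_code (3 ^ m - 1) g C" "C \<subseteq> carrier_vec (3 ^ m - 1)"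
        using C unfolding is_generator_poly_def cyclic_code_def by auto
      show "generates_code (3 ^ m - 1) g (multiples_code (3 ^ m - 1) g)"
        using generates_multiples_code[OF n g_dvd] .
    qed (simp add: multiples_code_def)
  qed (use facts in simp)
qed

section \<open>Sphere packing and dimension\<close>

text \<open>Coordinates with respect to a basis put the code in bijection with the functions from
  the basis to the field. This lets dimensions be computed and used by counting.\<close>

lemma card_linear_code:
  fixes C :: "'k::{field,finite} vec set"
  assumes "linear_code n C"
  shows "card C = CARD('k) ^ code_dim n C"
proof -
  let ?V = "module_vec TYPE('k) n\<lparr>carrier := C\<rparr>"
  have sub: "VectorSpace.subspace class_ring C (module_vec TYPE('k) n)"
    using assms unfolding linear_code_def .
  interpret V: vectorspace class_ring ?V
    using vectorspace.subspace_is_vs[OF vec_vs sub] .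
  have "C \<subseteq> carrier_vec n"
    using submodule.subset[OF subspace.submod[OF sub]] by (simp add: module_vec_simps)
  then have fin: "finite C" by (rule finite_subset) simp
  have "V.span C = C"
    using V.in_own_span[of C] V.span_is_subset2[of C] by auto
  then have "V.fin_dim" unfolding V.fin_dim_def using fin by (intro exI[of _ C]) auto
  then obtain B where B: "finite B" "V.basis B" using V.finite_basis_exists by blast
  then have BC: "B \<subseteq> carrier ?V" unfolding V.basis_def by blast
  have unique: "\<exists>!a. a \<in> B \<rightarrow>\<^sub>E UNIV \<and> V.lincomb a B = v" if "v \<in> C" for v
    using V.basis_criterion[OF B(1) BC] B(2) that by simp
  have "bij_betw (\<lambda>a. V.lincomb a B) (B \<rightarrow>\<^sub>E UNIV) C"
  proof (rule bij_betw_imageI)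
    have closed: "V.lincomb a B \<in> C" for a
      using V.lincomb_closed[OF BC, of a] by simp
    show "inj_on (\<lambda>a. V.lincomb a B) (B \<rightarrow>\<^sub>E UNIV)"
      using unique closed by (intro inj_onI) metis
    show "(\<lambda>a. V.lincomb a B) ` (B \<rightarrow>\<^sub>E UNIV) = C"
      using unique closed by (auto simp: image_iff) metis
  qed
  then have "card C = card (B \<rightarrow>\<^sub>E (UNIV :: 'k set))" using bij_betw_same_card by metis
  also have "\<dots> = CARD('k) ^ card B" using B(1) by (simp add: card_PiE)
  also have "card B = code_dim n C" using V.dim_basis[OF B] unfolding code_dim_def by simp
  finally show ?thesis .
qed

lemma linear_code_subset: "linear_code n C \<Longrightarrow> C \<subseteq> carrier_vec n"
  unfolding linear_code_def
  using submodule.subset subspace.submod by (fastforce simp: module_vec_simps)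

lemma double_sum_lessThan: "2 * (\<Sum>j<n. j) = n * (n - 1 :: nat)"
  by (induction n) (auto simp: algebra_simps)

text \<open>It suffices to count the words of weight exactly 2 in each ball of radius 2.\<close>

lemma min_distance_le_4:
  fixes D :: "gf3 vec set"
  assumes D: "D \<subseteq> carrier_vec n" and big: "3 ^ n < card D * (2 * (n * (n - 1)))"
  shows "min_distance D \<le> 4"
proof -
  \<comment> \<open>Ordering each support by \<open>i < j\<close> lists it once. The
    \<open>n * (n - 1) / 2\<close> supports with 4 sign choices each give
    \<open>2 * (n * (n - 1))\<close> error words.\<close>
  define pairs where "pairs = (SIGMA j:{..<n}. {..<j})"
  define S where "S = pairs \<times> ({1, - 1 :: gf3} \<times> {1, - 1 :: gf3})"
  define word where "word = (\<lambda>((j, i), (a, b)). vec n (\<lambda>k. if k = i then a else if k = j then b else (0::gf3)))"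
  have "(1::gf3) \<noteq> - 1"
  proof
    assume "(1::gf3) = - 1"
    then have "(of_nat 2 :: gf3) = 0" by (simp add: eq_neg_iff_add_eq_0)
    from of_nat_0_mod_ring_dvd[OF this] show False by (simp add: card_three)
  qed
  then have "card ({1, - 1 :: gf3} \<times> {1, - 1 :: gf3}) = 4" by (simp add: card_cartesian_product)
  moreover have "card pairs = (\<Sum>j<n. j)" unfolding pairs_def by simp
  ultimately have "card S = 2 * (n * (n - 1))"
    unfolding S_def card_cartesian_product using double_sum_lessThan[of n] by simp
  then have "card (carrier_vec n :: gf3 vec set) < card (D \<times> S)"
    using big card_carrier_vec[where ?'b = gf3 and n = n] by (simp add: card_cartesian_product card_three)
  moreover have "(\<lambda>(c, t). c + word t) ` (D \<times> S) \<subseteq> carrier_vec n"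
    using D unfolding word_def by auto
  \<comment> \<open>Pigeonhole: there are more pairs of a codeword and an error word than vectors of
    length \<open>n\<close>.\<close>
  ultimately have "\<not> inj_on (\<lambda>(c, t). c + word t) (D \<times> S)"
    using card_inj_on_le[of "\<lambda>(c, t). c + word t" "D \<times> S" "carrier_vec n"] by fastforce
  then obtain p p' where p: "p \<in> D \<times> S" "p' \<in> D \<times> S"
    "(\<lambda>(c, t). c + word t) p = (\<lambda>(c, t). c + word t) p'" "p \<noteq> p'"
    unfolding inj_on_def by blast
  obtain c t c' t' where "p = (c, t)" "p' = (c', t')" by (metis surj_pair)
  then have ct: "c \<in> D" "c' \<in> D" "t \<in> S" "t' \<in> S" "c + word t = c' + word t'"
    "(c, t) \<noteq> (c', t')"
    using p by auto
  obtain j i a b where t: "t = ((j, i), (a, b))" by (metis surj_pair)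
  obtain j' i' a' b' where t': "t' = ((j', i'), (a', b'))" by (metis surj_pair)
  have ij: "i < j" "j < n" "i' < j'" "j' < n" "a \<noteq> 0" "b \<noteq> 0" "a' \<noteq> 0" "b' \<noteq> 0"
    using ct(3,4) unfolding t t' S_def pairs_def by auto
  have dims: "dim_vec c = n" "dim_vec c' = n" using ct D by auto
  have eq: "c $ k + (if k = i then a else if k = j then b else 0)
      = c' $ k + (if k = i' then a' else if k = j' then b' else 0)" if "k < n" for k
    using arg_cong[OF ct(5), of "\<lambda>v. v $ k"] that dims unfolding word_def t t' by simp
  have "c \<noteq> c'"
  \<comment> \<open>If the codewords were equal, so would be the error words; their nonzero
    positions and the order \<open>i < j\<close> recover the index, against the choice of distinct
    pairs.\<close>
  proof
    assume "c = c'"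
    then have w: "(if k = i then a else if k = j then b else 0)
      = (if k = i' then a' else if k = j' then b' else 0)" if "k < n" for k
      using eq[OF that] by simp
    have "i = i' \<or> i = j'" "j = i' \<or> j = j'" "i' = i \<or> i' = j"
      using w[of i] w[of j] w[of i'] ij by (auto split: if_splits)
    then have "i = i'" "j = j'" using ij by auto
    then have "a = a'" "b = b'" using w[of i] w[of j] ij by auto
    then show False using ct(6) \<open>c = c'\<close> \<open>i = i'\<close> \<open>j = j'\<close> unfolding t t' by simp
  qed
  have "{k. k < dim_vec c \<and> c $ k \<noteq> c' $ k} \<subseteq> {i, j, i', j'}"
  proof
    fix k assume k: "k \<in> {k. k < dim_vec c \<and> c $ k \<noteq> c' $ k}"
    show "k \<in> {i, j, i', j'}"
    proof (rule ccontr)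
      assume "k \<notin> {i, j, i', j'}"
      moreover have "k < n" using k dims by simp
      ultimately have "c $ k = c' $ k" using eq[of k] by simp
      then show False using k by simp
    qed
  qed
  then have "hamming_dist c c' \<le> card {i, j, i', j'}"
    unfolding hamming_dist_def by (intro card_mono) auto
  also have "\<dots> \<le> 4" using card_length[of "[i, j, i', j']"] by simp
  finally have "hamming_dist c c' \<le> 4" .
  moreover have "min_distance D \<le> hamming_dist c c'"
    unfolding min_distance_def using ct(1,2) \<open>c \<noteq> c'\<close> by (intro cInf_lower) auto
  ultimately show ?thesis by simp
qed

text \<open>Two distinct words must be supplied because the infimum of the empty set is 0.\<close>

lemma le_min_distance:
  assumes "u \<in> C" "v \<in> C" "u \<noteq> v"
    and "\<And>u v. u \<in> C \<Longrightarrow> v \<in> C \<Longrightarrow> u \<noteq> v \<Longrightarrow> d \<le> hamming_dist u v"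
  shows "d \<le> min_distance C"
  unfolding min_distance_def using assms by (intro cInf_greatest) auto

lemma linear_code_multiples_code: "linear_code n (multiples_code n (g :: 'k::field poly))"
proof -
  have [simp]: "word_poly n (0\<^sub>v n :: 'k vec) = 0"
    by (intro poly_eqI) (simp add: coeff_word_poly)
  have [simp]: "word_poly n (u + v) = word_poly n u + word_poly n v"
    if "u \<in> carrier_vec n" "v \<in> carrier_vec n" for u v :: "'k vec"
    using that by (intro poly_eqI) (simp add: coeff_word_poly)
  have [simp]: "word_poly n (a \<cdot>\<^sub>v u) = Polynomial.smult a (word_poly n u)"
    if "u \<in> carrier_vec n" for u :: "'k vec" and a
    using that by (intro poly_eqI) (simp add: coeff_word_poly)
  have "submodule class_ring (multiples_code n g) (module_vec TYPE('k) n)"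
    by (intro submodule.intro vec_module)
      (auto simp: multiples_code_def module_vec_simps dvd_smult)
  then show ?thesis unfolding linear_code_def by (intro subspace.intro vec_vs)
qed

lemma coeff_eq_0_iff_degree_less:
  "(\<forall>i\<ge>n. coeff p i = 0) \<longleftrightarrow> p = 0 \<or> degree p < n"
proof
  assume "\<forall>i\<ge>n. coeff p i = 0"
  then show "p = 0 \<or> degree p < n" by (metis leading_coeff_0_iff not_less)
qed (auto intro: coeff_eq_0)

text \<open>Multiplication by \<open>g\<close> maps the polynomials below
  \<open>n - degree g\<close> bijectively onto the multiples of \<open>g\<close> below
  \<open>n\<close>. If \<open>degree g \<ge> n\<close>, both sets consist of 0 alone, in line with
  truncated subtraction.\<close>

lemma card_multiples_code:
  fixes g :: "gf3 poly"
  assumes "g \<noteq> 0"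
  shows "card (multiples_code n g) = 3 ^ (n - degree g)"
proof -
  let ?A = "{p :: gf3 poly. \<forall>i\<ge>n - degree g. coeff p i = 0}"
  let ?B = "{p. (\<forall>i\<ge>n. coeff p i = 0) \<and> g dvd p}"
  have "bij_betw ((*) g) ?A ?B"
  proof (rule bij_betw_imageI)
    show "inj_on ((*) g) ?A" using assms by (auto intro: inj_onI)
    have "p = 0 \<or> degree p < n - degree g \<longleftrightarrow> g * p = 0 \<or> degree (g * p) < n" for p
      using assms by (cases "p = 0") (auto simp: degree_mult_eq)
    then show "(*) g ` ?A = ?B"
      unfolding coeff_eq_0_iff_degree_less by (auto simp: dvd_def image_iff)
  qed
  moreover have "bij_betw (word_poly n) (multiples_code n g) ?B"
  proof (rule bij_betw_imageI)
    note bij = bij_betw_word_poly[where ?'k = gf3 and n = n]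
    show "inj_on (word_poly n) (multiples_code n g)"
      using bij_betw_imp_inj_on[OF bij] by (rule inj_on_subset) (auto simp: multiples_code_def)
    have "word_poly n ` multiples_code n g = word_poly n ` carrier_vec n \<inter> {p. g dvd p}"
      unfolding multiples_code_def by auto
    then show "word_poly n ` multiples_code n g = ?B"
      unfolding bij_betw_imp_surj_on[OF bij] by auto
  qed
  ultimately have "card (multiples_code n g) = card ?A"
    using bij_betw_same_card[of "(*) g" ?A ?B] bij_betw_same_card[of "word_poly n" _ ?B] by simp
  then show ?thesis by (simp add: card_polys_below)
qed

section \<open>The code with two zeros\<close>

text \<open>Multiplication by \<open>x\<close> permutes the nonzero elements, so their product is
  unchanged by the factor \<open>x ^ (CARD('a) - 1)\<close>.\<close>

lemma finite_field_power_card_minus_1: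
  fixes x :: "'a::{field,finite}"
  assumes "x \<noteq> 0"
  shows "x ^ (CARD('a) - 1) = 1"
proof -
  have "(\<Prod>y\<in>UNIV - {0}. x * y) = (\<Prod>y\<in>UNIV - {0}. y)"
    by (rule prod.reindex_bij_witness[of _ "\<lambda>y. y / x" "\<lambda>y. x * y"]) (use assms in auto)
  moreover have "(\<Prod>y\<in>UNIV - {0}. x * y) = x ^ (CARD('a) - 1) * (\<Prod>y\<in>UNIV - {0}. y)"
    by (simp add: prod.distrib card_Diff_singleton)
  moreover have "(\<Prod>y\<in>UNIV - {0 :: 'a}. y) \<noteq> 0" by simp
  ultimately show ?thesis by simp
qed

lemma power_int_cong:
  fixes x :: "'a::field"
  assumes "x \<noteq> 0" "x ^ n = 1" "[i = j] (mod int n)"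
  shows "x powi i = x powi j"
proof -
  obtain k where "i = j + int n * k"
    using assms(3) by (metis cong_iff_lin cong_sym)
  then have "x powi i = x powi j * (x powi int n) powi k"
    using assms(1) by (simp add: power_int_add power_int_mult)
  then show ?thesis using assms(2) by simp
qed

lemma power_int_eq_1_coprime:
  fixes x :: "'a::field"
  assumes "x \<noteq> 0" "x powi i = 1" "x powi j = 1" "gcd i j = 1"
  shows "x = 1"
proof -
  obtain u v where "u * i + v * j = 1" using bezout_int[of i j] assms(4) by auto
  then have "x = x powi (i * u + j * v)" by (simp add: mult.commute)
  also have "\<dots> = (x powi i) powi u * (x powi j) powi v"
    using assms(1) by (simp add: power_int_add power_int_mult)
  finally show ?thesis using assms(2,3) by simp
qed

section \<open>Primitive elements of a finite field\<close>

locale primitive_element =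
  fixes \<alpha> :: "'a::{field,finite}" and n :: nat
  assumes primitive: "is_primitive \<alpha>"
    and card_eq_Suc: "CARD('a) = Suc n"
begin

lemma power_n: "(x :: 'a) \<noteq> 0 \<Longrightarrow> x ^ n = 1"
  using finite_field_power_card_minus_1[of x] card_eq_Suc by simp

lemma \<alpha>_nonzero: "\<alpha> \<noteq> 0"
proof -
  have "\<alpha> = \<alpha> powi 1" by simp
  then have "\<alpha> \<in> range (\<lambda>k::int. \<alpha> powi k)" by (rule range_eqI)
  then show ?thesis using primitive unfolding is_primitive_def by auto
qed

lemma n_pos: "0 < n"
  using card_mono[of UNIV "{0, 1 :: 'a}"] card_eq_Suc by simp

lemma nonzero_eq_power:
  assumes "x \<noteq> 0"
  obtains k where "k < n" "x = \<alpha> ^ k"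
proof -
  have "x \<in> range (\<lambda>k::int. \<alpha> powi k)"
    using assms primitive unfolding is_primitive_def by simp
  then obtain i where i: "x = \<alpha> powi i" by auto
  note n = n_pos
  have "\<alpha> powi i = \<alpha> powi (i mod int n)"
    by (rule power_int_cong[OF \<alpha>_nonzero power_n[OF \<alpha>_nonzero]])
      (simp add: cong_def)
  also have "i mod int n = int (nat (i mod int n))" using n by simp
  finally have "x = \<alpha> ^ nat (i mod int n)" using i by (metis power_int_of_nat)
  moreover have "nat (i mod int n) < n" using n by (simp add: nat_less_iff)
  ultimately show ?thesis using that by blast
qed

text \<open>The \<open>n\<close> exponents reach all \<open>n\<close> nonzero elements, so no value
  is repeated.\<close>

lemma inj_on_powers: "inj_on (\<lambda>k. \<alpha> ^ k) {..<n}"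
proof (rule eq_card_imp_inj_on)
  have "(\<lambda>k. \<alpha> ^ k) ` {..<n} = UNIV - {0}"
    using \<alpha>_nonzero by (auto elim: nonzero_eq_power)
  then show "card ((\<lambda>k. \<alpha> ^ k) ` {..<n}) = card {..<n}" by (simp add: card_Diff_singleton card_eq_Suc)
qed simp

lemma power_half_neq_1:
  assumes "even n"
  shows "\<alpha> ^ (n div 2) \<noteq> 1"
proof
  assume "\<alpha> ^ (n div 2) = 1"
  then have "n div 2 = 0"
    using inj_onD[OF inj_on_powers, of "n div 2" 0] n_pos by simp
  then show False using assms n_pos by (auto elim!: evenE)
qed

lemma not_square:
  assumes "even n"
  shows "\<alpha> \<noteq> y\<^sup>2"
proof
  assume y: "\<alpha> = y\<^sup>2"
  then have "y \<noteq> 0" using \<alpha>_nonzero by auto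
  have "\<alpha> ^ (n div 2) = y ^ n" unfolding y using assms by (simp flip: power_mult)
  then show False using power_half_neq_1[OF assms] power_n[OF \<open>y \<noteq> 0\<close>] by simp
qed

text \<open>The image is closed under powers, so with \<alpha> it contains every nonzero
  element.\<close>

lemma surj_evaluation:
  assumes "(3::'a) = 0" "\<alpha> = poly (map_poly gf3_embed p) x"
  shows "range (\<lambda>p. poly (map_poly gf3_embed p) x) = UNIV"
proof -
  interpret ternary_evaluation x using assms(1) by unfold_locales
  have "y \<in> range ev" for y
  proof (cases "y = 0")
    case True
    then have "y = ev 0" by simp
    then show ?thesis by (rule range_eqI)
  next
    case False
    then obtain k where "y = ev (p ^ k)"
      using nonzero_eq_power assms(2) by (metis ev.hom_power)
    then show ?thesis by (rule range_eqI)
  qed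
  then show ?thesis by auto
qed

end

lemma gf3_embed_diff_cases:
  assumes "(3::'a::field) = 0" "(c::gf3) \<noteq> d"
  shows "(gf3_embed (c - d) :: 'a) = 1 \<or> (gf3_embed (c - d) :: 'a) = - 1"
proof -
  interpret comm_ring_hom "gf3_embed :: gf3 \<Rightarrow> 'a" using gf3_embed_hom[OF assms(1)] .
  show ?thesis
    using gf3_cases[of "c - d"] assms(2) hom_one hom_uminus[of 1] by (metis right_minus_eq)
qed

section \<open>The field with \<open>3 ^ m\<close> elements and the exponents \<open>h\<close> and
  \<open>e\<close>\<close>

locale optimal_exponents = primitive_element \<alpha> n for \<alpha> :: "'a::{field,finite}" and n +
  fixes m h :: nat and e :: int
  assumes card_field: "CARD('a) = 3 ^ m"
    and odd_m: "odd m"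
    and h: "1 \<le> h" "h \<le> m - 1"
    and even_e: "even e"
    and e_cong: "[e * (3 ^ h - 1) = (3 ^ m + 1) div 2] (mod (3 ^ m - 1))"
    and gcd_eq_1: "gcd (3 ^ m - 1) (3 ^ h - 2 :: int) = 1"
begin

definition \<chi> :: "'a \<Rightarrow> 'a" where
  "\<chi> x = x ^ (n div 2)"

lemma n_eq: "n = 3 ^ m - 1"
  using card_eq_Suc card_field by simp

lemma m_ge_3: "3 \<le> m"
  using h odd_m by presburger

lemma char3: "CHAR('a) = 3"
proof -
  have p: "prime CHAR('a)" by (rule prime_CHAR_semidom) (simp add: finite_imp_CHAR_pos)
  have "CHAR('a) dvd 3 ^ m" using CHAR_dvd_CARD[where ?'a = 'a] card_field by simp
  then have "CHAR('a) dvd 3" using p prime_dvd_power by blast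
  then show ?thesis using p primes_dvd_imp_eq[of "CHAR('a)" 3] by simp
qed

lemma three_eq_0: "(3::'a) = 0"
  using of_nat_CHAR[where ?'a = 'a] by (simp add: char3)

text \<open>An odd power of 3 is 3 modulo 4. Hence \<open>n div 2\<close> is odd, which is what
  makes \<open>\<chi>\<close> change sign under negation.\<close>

lemma n_mod_4: "n mod 4 = 2"
proof -
  obtain k where "m = 2 * k + 1" using odd_m by (rule oddE)
  then have n: "n = 3 * 9 ^ k - 1" unfolding n_eq by (simp add: power_mult)
  have "(9::nat) ^ k mod 4 = (9 mod 4) ^ k mod 4" by (simp only: power_mod)
  then have "(9::nat) ^ k mod 4 = 1" by simp
  then have "(9::nat) ^ k = 4 * (9 ^ k div 4) + 1" by (metis mult_div_mod_eq)
  then obtain t where "(9::nat) ^ k = 4 * t + 1" by blast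
  then have "n = 2 + 4 * (3 * t)" unfolding n by simp
  then show ?thesis by (simp only: mod_mult_self2) simp
qed

lemma half_odd: "odd (n div 2)" and even_n: "even n" and half: "2 * (n div 2) = n"
  using n_mod_4 by presburger+

text \<open>The exponent \<open>(3 ^ m + 1) div 2\<close> is \<open>n div 2 + 1\<close>, and the
  part \<open>n div 2\<close> contributes the character.\<close>

lemma e_twist:
  assumes "x \<noteq> 0"
  shows "x powi (e * (3 ^ h - 1)) = \<chi> x * x"
proof -
  have "int n = 3 ^ m - 1" using n_eq by (simp add: of_nat_diff)
  moreover have "(3 ^ m + 1) div 2 = int (n div 2 + 1)"
    using half \<open>int n = 3 ^ m - 1\<close> by linarith
  ultimately have "x powi (e * (3 ^ h - 1)) = x powi int (n div 2 + 1)"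
    using power_int_cong[OF assms power_n[OF assms]] e_cong by metis
  then show ?thesis by (simp only: power_int_of_nat \<chi>_def power_add) simp
qed

sublocale twisted_power "\<lambda>x. x powi e" "\<lambda>x. x ^ (3 ^ h)" \<chi>
proof
  show "(3::'a) = 0" by (rule three_eq_0)
  show "(x * y) powi e = x powi e * y powi e" for x y :: 'a by (rule power_int_mult_distrib)
  show "(- x) powi e = x powi e" for x :: 'a using even_e by simp
  show "x powi e \<noteq> 0" if "x \<noteq> 0" for x :: 'a using that by simp
  show "(x + y) ^ (3 ^ h) = x ^ (3 ^ h) + y ^ (3 ^ h)" for x y :: 'a
    by (rule freshmans_dream') (simp_all add: char3)
  show "\<chi> (x * y) = \<chi> x * \<chi> y" for x y unfolding \<chi>_def by (rule power_mult_distrib)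
  show "\<chi> (- x) = - \<chi> x" for x unfolding \<chi>_def using half_odd by simp
  have sq: "(\<chi> x)\<^sup>2 = 1" if "x \<noteq> 0" for x
    unfolding \<chi>_def using power_n[OF that] half by (metis power_mult mult.commute)
  then show "\<chi> x = 1 \<or> \<chi> x = - 1" if "x \<noteq> 0" for x
    using that by (simp add: power2_eq_1_iff)
  show "\<chi> (x powi e) = 1" if "x \<noteq> 0" for x
  proof -
    obtain f where "e = f * 2" using even_e by (metis evenE mult.commute)
    then have "x powi e = (x powi f)\<^sup>2" by (simp add: power_int_mult)
    then have "\<chi> (x powi e) = (\<chi> (x powi f))\<^sup>2" unfolding \<chi>_def by (simp flip: power_mult add: mult.commute)
    then show ?thesis using sq that by simp
  qed
  show "(x powi e) ^ (3 ^ h) = \<chi> x * x * x powi e" if "x \<noteq> 0" for x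
  proof -
    have "(x powi e) ^ (3 ^ h) = x powi (e * int (3 ^ h))"
      by (simp only: power_int_mult power_int_of_nat)
    \<comment> \<open>The split isolates the multiple of \<open>e\<close> that the congruence
      controls.\<close>
    also have "e * int (3 ^ h) = e * (3 ^ h - 1) + e" by (simp add: algebra_simps)
    finally show ?thesis using e_twist[OF that] that by (simp add: power_int_add)
  qed
  \<comment> \<open>Division by \<open>w\<^sup>2\<close> makes the \<open>3 ^ h - 2\<close>-th power
    of \<open>w\<close> equal to 1, as its \<open>3 ^ m - 1\<close>-th power is; the two exponents
    are coprime.\<close>
  show "w = 1" if w: "w \<noteq> 0" "w ^ (3 ^ h) = w\<^sup>2" for w :: 'a
  proof (rule power_int_eq_1_coprime[OF w(1) _ _ gcd_eq_1])
    have "w powi int n = 1" using power_n[OF w(1)] by simp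
    then show "w powi (3 ^ m - 1) = 1" using n_eq by (simp add: of_nat_diff)
    have "w powi (3 ^ h - 2) = w powi int (3 ^ h) / w powi 2"
      using w(1) by (simp add: power_int_diff)
    also have "\<dots> = 1" using w by (simp only: power_int_of_nat) simp
    finally show "w powi (3 ^ h - 2) = 1" .
  qed
qed

section \<open>The two zeros and the generator polynomial\<close>

abbreviation \<beta> where "\<beta> \<equiv> \<alpha> powi e"

lemma \<beta>_nonzero: "\<beta> \<noteq> 0" using \<alpha>_nonzero by simp

sublocale at_\<alpha>: ternary_evaluation \<alpha> using three_eq_0 by unfold_locales
sublocale at_\<beta>: ternary_evaluation \<beta> using three_eq_0 by unfold_locales

lemma range_ev_\<alpha>: "range at_\<alpha>.ev = UNIV"
proof (rule surj_evaluation[OF three_eq_0])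
  show "\<alpha> = at_\<alpha>.ev (monom 1 1)" by (simp only: at_\<alpha>.ev_monom) simp
qed

text \<open>The twist gives \<open>\<beta> ^ (3 ^ h - 1) = \<chi> \<alpha> * \<alpha>\<close>, and
  \<open>\<chi> \<alpha> = - 1\<close> because \<alpha> is primitive. So \<alpha> is a polynomial
  value at \<beta>.\<close>

lemma range_ev_\<beta>: "range at_\<beta>.ev = UNIV"
proof (rule surj_evaluation[OF three_eq_0])
  have "\<chi> \<alpha> * \<alpha> = \<beta> powi (3 ^ h - 1)"
    using e_twist[OF \<alpha>_nonzero] by (simp add: power_int_mult)
  also have "(3 ^ h - 1 :: int) = int (3 ^ h - 1)" by (simp add: of_nat_diff)
  finally have "\<chi> \<alpha> * \<alpha> = \<beta> ^ (3 ^ h - 1)" by (simp only: power_int_of_nat)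
  then have "\<chi> \<alpha> * \<alpha> = at_\<beta>.ev (monom 1 (3 ^ h - 1))" by (simp only: at_\<beta>.ev_monom) simp
  moreover have "\<chi> \<alpha> = - 1"
    using \<chi>_cases[OF \<alpha>_nonzero] power_half_neq_1[OF even_n] unfolding \<chi>_def by blast
  ultimately show "\<alpha> = at_\<beta>.ev (- monom 1 (3 ^ h - 1))" 
    by (simp only: at_\<beta>.ev.hom_uminus) (metis minus_minus mult_minus1)
qed

lemma degree_\<alpha>: "degree (min_poly \<alpha>) = m"
  using at_\<alpha>.card_range_ev unfolding range_ev_\<alpha> card_field by simp

lemma degree_\<beta>: "degree (min_poly \<beta>) = m"
  using at_\<beta>.card_range_ev unfolding range_ev_\<beta> card_field by simp

text \<open>
  Write a square root of \<open>\<beta>\<close> as the value of \<open>p\<close> at \<open>\<beta>\<close>. If the minimal polynomials were not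
  coprime, the value of \<open>p\<close> at \<open>\<alpha>\<close> would be a square root of \<open>\<alpha>\<close>.
\<close>

lemma coprime_min_polys: "algebraic_semidom_class.coprime (min_poly \<alpha>) (min_poly \<beta>)"
proof (rule prime_elem_imp_coprime[OF at_\<alpha>.prime_elem_min_poly], rule notI)
  assume "min_poly \<alpha> dvd min_poly \<beta>"
  obtain f where f: "e = f * 2" using even_e by (metis evenE mult.commute)
  have "\<alpha> powi f \<in> range at_\<beta>.ev" unfolding range_ev_\<beta> by (rule UNIV_I)
  then obtain p where p: "\<alpha> powi f = at_\<beta>.ev p" by (rule rangeE)
  have "at_\<beta>.ev (p\<^sup>2 - monom 1 1) = (\<alpha> powi f)\<^sup>2 - \<beta>"
    using p by (simp only: at_\<beta>.ev.hom_minus at_\<beta>.ev.hom_power at_\<beta>.ev_monom) simp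
  also have "\<dots> = 0" unfolding f by (simp add: power_int_mult)
  finally have "min_poly \<beta> dvd p\<^sup>2 - monom 1 1" using at_\<beta>.min_poly_dvd_iff by blast
  then have "at_\<alpha>.ev (p\<^sup>2 - monom 1 1) = 0"
    using \<open>min_poly \<alpha> dvd min_poly \<beta>\<close> at_\<alpha>.min_poly_dvd_iff dvd_trans by blast
  then have "(at_\<alpha>.ev p)\<^sup>2 = \<alpha>"
    by (simp only: at_\<alpha>.ev.hom_minus at_\<alpha>.ev.hom_power at_\<alpha>.ev_monom) simp
  then show False using not_square[OF even_n] by metis
qed

abbreviation "g \<equiv> min_poly \<alpha> * min_poly \<beta>"

text \<open>Coprimality of the factors turns membership in the code into two parity checks, one at
  each zero.\<close>

lemma g_dvd_iff: "g dvd p \<longleftrightarrow> at_\<alpha>.ev p = 0 \<and> at_\<beta>.ev p = 0"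
  unfolding at_\<alpha>.min_poly_dvd_iff at_\<beta>.min_poly_dvd_iff
proof (intro iffI conjI)
  show "min_poly \<alpha> dvd p" if "g dvd p" using that by (rule dvd_mult_left)
  show "min_poly \<beta> dvd p" if "g dvd p" using that by (rule dvd_mult_right)
  show "g dvd p" if "min_poly \<alpha> dvd p \<and> min_poly \<beta> dvd p"
    using that by (intro divides_mult[OF _ _ coprime_min_polys]) simp_all
qed

lemma monic_g: "monic g"
  using at_\<alpha>.monic_min_poly at_\<beta>.monic_min_poly by (simp add: lead_coeff_mult)

lemma degree_g: "degree g = 2 * m"
  using at_\<alpha>.min_poly_nonzero at_\<beta>.min_poly_nonzero degree_\<alpha> degree_\<beta> by (simp add: degree_mult_eq)

lemma g_dvd_x_pow_minus_1: "g dvd x_pow_minus_1 n"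
proof -
  have "at_\<alpha>.ev (x_pow_minus_1 n) = \<alpha> ^ n - 1"
    by (simp only: at_\<alpha>.ev.hom_minus at_\<alpha>.ev_monom at_\<alpha>.ev.hom_one at_\<alpha>.embed.hom_one mult_1)
  moreover have "at_\<beta>.ev (x_pow_minus_1 n) = \<beta> ^ n - 1"
    by (simp only: at_\<beta>.ev.hom_minus at_\<beta>.ev_monom at_\<beta>.ev.hom_one at_\<alpha>.embed.hom_one mult_1)
  ultimately show ?thesis
    unfolding g_dvd_iff using power_n[OF \<alpha>_nonzero] power_n[OF \<beta>_nonzero] by simp
qed

lemma code_eq: "ternary_cyclic_code m \<alpha> [1, e] = multiples_code n g"
  unfolding n_eq
proof (rule ternary_cyclic_code_eq)
  show "1 \<le> m" using m_ge_3 by simp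
  show "g = prod_list (map (\<lambda>i. min_poly (\<alpha> powi i)) [1, e])" by simp
  show "monic g" by (rule monic_g)
  show "g dvd x_pow_minus_1 (3 ^ m - 1)" using g_dvd_x_pow_minus_1 unfolding n_eq .
qed

text \<open>On the set \<open>S\<close> of differing positions the two parity checks are signed sums
  of the \<open>\<alpha> ^ i\<close> and of their \<open>e\<close>-th powers. One term cannot
  vanish, and two or three terms fall under the relations excluded above.\<close>

lemma hamming_dist_ge_4:
  assumes u: "u \<in> multiples_code n g" and v: "v \<in> multiples_code n g" and "u \<noteq> v"
  shows "4 \<le> hamming_dist u v"
proof (rule ccontr)
  define S where "S = {i. i < n \<and> u $ i \<noteq> v $ i}"
  define w :: "nat \<Rightarrow> 'a" where "w i = gf3_embed (u $ i - v $ i)" for i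
  have uv: "u \<in> carrier_vec n" "v \<in> carrier_vec n"
    "g dvd word_poly n u" "g dvd word_poly n v"
    using u v unfolding multiples_code_def by blast+
  then have dims: "dim_vec u = n" "dim_vec v = n" by (simp_all only: carrier_vecD)
  have fin: "finite S" unfolding S_def by simp
  have sum0: "(\<Sum>i\<in>S. w i * x ^ i) = 0"
    if ev: "poly (map_poly gf3_embed (word_poly n u)) x = 0"
      "poly (map_poly gf3_embed (word_poly n v)) x = 0" for x :: 'a
  proof -
    interpret ternary_evaluation x using three_eq_0 by unfold_locales
    have "(\<Sum>i\<in>S. w i * x ^ i) = (\<Sum>i<n. w i * x ^ i)"
      by (rule sum.mono_neutral_left) (auto simp: S_def w_def)
    also have "\<dots> = (\<Sum>i<n. gf3_embed (u $ i) * x ^ i) - (\<Sum>i<n. gf3_embed (v $ i) * x ^ i)"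
      unfolding w_def sum_subtractf[symmetric] by (simp add: at_\<alpha>.embed.hom_minus algebra_simps)
    also have "\<dots> = 0" using ev unfolding ev_word_poly by simp
    finally show ?thesis .
  qed
  have s\<alpha>: "(\<Sum>i\<in>S. w i * \<alpha> ^ i) = 0"
    using sum0[of \<alpha>] uv g_dvd_iff by blast
  have "(\<Sum>i\<in>S. w i * \<beta> ^ i) = 0"
    using sum0[of \<beta>] uv g_dvd_iff by blast
  \<comment> \<open>Swapping exponents puts the check at \<beta> into the form of a relation between
    \<open>e\<close>-th powers of the \<open>\<alpha> ^ i\<close>.\<close>
  moreover have "\<beta> ^ i = (\<alpha> ^ i) powi e" for i
    by (metis power_int_mult power_int_of_nat mult.commute)
  ultimately have s\<beta>: "(\<Sum>i\<in>S. w i * (\<alpha> ^ i) powi e) = 0" by simp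
  have w: "w i = 1 \<or> w i = - 1" if "i \<in> S" for i
    unfolding w_def by (rule gf3_embed_diff_cases[OF three_eq_0]) (use that in \<open>simp add: S_def\<close>)
  have ne: "\<alpha> ^ i \<noteq> \<alpha> ^ j" if "i \<in> S" "j \<in> S" "i \<noteq> j" for i j
    using that inj_on_powers unfolding S_def inj_on_def by blast
  have nz: "\<alpha> ^ i \<noteq> 0" for i using \<alpha>_nonzero by simp
  have "S \<noteq> {}" using \<open>u \<noteq> v\<close> dims unfolding S_def by (auto intro!: eq_vecI)
  assume "\<not> 4 \<le> hamming_dist u v"
  then have "card S < 4" unfolding hamming_dist_def S_def dims by simp
  moreover have "card S \<noteq> 0" using \<open>S \<noteq> {}\<close> fin by simp
  ultimately consider "card S = 1" | "card S = 2" | "card S = 3" by linarith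
  then show False
  proof cases
    case 1
    then obtain i where "S = {i}" by (rule card_1_singletonE)
    then show False using s\<alpha> w[of i] nz[of i] by auto
  next
    case 2
    then obtain i j where S: "S = {i, j}" "i \<noteq> j" by (auto simp: card_2_iff)
    show False
      by (rule no_weight_2_relation[of "\<alpha> ^ i" "\<alpha> ^ j" "w i" "w j"])
        (use S s\<alpha> s\<beta> w ne nz in auto)
  next
    case 3
    then obtain i j k where S: "S = {i, j, k}" "i \<noteq> j" "j \<noteq> k" "i \<noteq> k"
      by (auto simp: card_3_iff)
    show False
      by (rule no_weight_3_relation[of "\<alpha> ^ i" "\<alpha> ^ j" "\<alpha> ^ k" "w i" "w j" "w k"])
        (use S s\<alpha> s\<beta> w ne nz in \<open>auto simp: add.assoc\<close>)
  qed
qed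

lemma field_size_ge: "27 \<le> (3::nat) ^ m"
  using power_increasing[OF m_ge_3, of "3::nat"] by simp

text \<open>This makes \<open>n - 2 * m\<close> a genuine difference and guarantees at least two
  codewords.\<close>

lemma dim_less: "2 * m < n"
proof -
  have "2 * k + 1 < (3::nat) ^ k" if "3 \<le> k" for k
    using that by (induction k rule: dec_induct) auto
  from this[OF m_ge_3] show ?thesis unfolding n_eq by simp
qed

text \<open>A code of this dimension has \<open>3 ^ (n - 2 * m)\<close> words, so the
  \<open>2 * (n * (n - 1))\<close> error words only have to outnumber
  \<open>3 ^ (2 * m)\<close>.\<close>

lemma min_distance_le_4_of_dim:
  fixes D :: "gf3 vec set"
  assumes "linear_code n D" "code_dim n D = n - 2 * m"
  shows "min_distance D \<le> 4"
proof (rule min_distance_le_4[OF linear_code_subset[OF assms(1)]])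
  \<comment> \<open>With \<open>3 ^ m = k + 6\<close> the inequality compares
    \<open>k^2 + 12 k + 36\<close> with \<open>2 k^2 + 18 k + 40\<close>, free of truncated
    subtraction.\<close>
  obtain k where k: "(3::nat) ^ m = k + 6"
    using that[of "3 ^ m - 6"] field_size_ge by simp
  have "(3::nat) ^ m * 3 ^ m < 2 * (n * (n - 1))"
    unfolding n_eq k by (simp add: algebra_simps)
  then have "3 ^ (n - 2 * m) * (3 ^ m * 3 ^ m) < 3 ^ (n - 2 * m) * (2 * (n * (n - 1)))"
    by (rule mult_strict_left_mono) simp
  moreover have "n = (n - 2 * m) + (m + m)" using dim_less by simp
  then have "(3::nat) ^ n = 3 ^ (n - 2 * m) * (3 ^ m * 3 ^ m)" by (metis power_add)
  moreover have "card D = 3 ^ (n - 2 * m)"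
    using card_linear_code[OF assms(1)] assms(2) by (simp add: card_three)
  ultimately show "3 ^ n < card D * (2 * (n * (n - 1)))" by (simp only:)
qed

text \<open>The upper bound holds for every linear code of this length and dimension: applied to the
  code itself it fixes the distance at 4, applied to the others it gives optimality.\<close>

lemma parameters_and_optimality:
  "has_parameters (ternary_cyclic_code m \<alpha> [1, e]) n (n - 2 * m) 4 \<and>
   optimal_code n (ternary_cyclic_code m \<alpha> [1, e])"
proof -
  let ?C = "multiples_code n g"
  have lin: "linear_code n ?C" by (rule linear_code_multiples_code)
  have card: "card ?C = 3 ^ (n - 2 * m)"
    using card_multiples_code[of g n] monic_g degree_g by fastforce
  then have dim: "code_dim n ?C = n - 2 * m"
    using card_linear_code[OF lin] by (simp add: card_three)
  have "1 < card ?C"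
    unfolding card using dim_less one_less_power[of "3::nat" "n - 2 * m"] by simp
  then have "finite ?C" "\<not> card ?C \<le> Suc 0" by (auto intro: card_ge_0_finite)
  then obtain u v where uv: "u \<in> ?C" "v \<in> ?C" "u \<noteq> v"
    using card_le_Suc0_iff_eq by blast
  have "4 \<le> min_distance ?C" using le_min_distance[OF uv] hamming_dist_ge_4 by blast
  moreover have "min_distance ?C \<le> 4" using min_distance_le_4_of_dim[OF lin dim] .
  ultimately have dist: "min_distance ?C = 4" by simp
  show ?thesis
    unfolding code_eq has_parameters_def optimal_code_def dist dim
    using lin min_distance_le_4_of_dim by auto
qed

end

theorem theorem4:
  fixes \<alpha> :: "'a::{field,finite}" and m h :: nat and e :: int
  assumes "CARD('a) = 3 ^ m"
    and "is_primitive \<alpha>"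
    and "odd m"
    and "1 \<le> h" and "h \<le> m - 1"
    and "even e"
    and "[e * (3 ^ h - 1) = (3 ^ m + 1) div 2] (mod (3 ^ m - 1))"
    and "gcd (3 ^ m - 1) (3 ^ h - 2 :: int) = 1"
  shows "has_parameters (ternary_cyclic_code m \<alpha> [1, e])
           (3 ^ m - 1) (3 ^ m - 2 * m - 1) 4 \<and>
         optimal_code (3 ^ m - 1) (ternary_cyclic_code m \<alpha> [1, e])"
proof -
  interpret optimal_exponents \<alpha> "3 ^ m - 1" m h e
    using assms by unfold_locales simp_all
  have "(3::nat) ^ m - 2 * m - 1 = 3 ^ m - 1 - 2 * m" by simp
  then show ?thesis using parameters_and_optimality by simp
qed

end
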